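(* Let $K$ and $L$ be connected graphs. (a') Every $1$-cycle in $K\mathbin{\square}L$ is a sum of a right cycle, a left cycle and several boundaries. (a) For every $1$-cycle $C$ in $K\mathbin{\square}L$ and all vertices $a$ of $K$ and $b$ of $L$: (a1) there exist unique $1$-cycles $C_K$ in $K$ and $C_L$ in $L$ such that $C\sim C_K\mathbin{\square}b+a\mathbin{\square}C_L$; (a2) $C\sim C_x\mathbin{\square}b+a\mathbin{\square}C_y$. (b) The number of homology classes of $1$-cycles in $K\mathbin{\square}L$ equals the product of the number of $1$-cycles in $K$ and the number of $1$-cycles in $L$.
   Context: A graph is a finite simple graph. A $1$-cycle in a graph is a set of edges (possibly empty) such that every vertex belongs to an even number of edges of the set. The sum of sets is the symmetric difference (sum modulo $2$); "several" allows zero summands. The graph $K\mathbin{\square}L$ has as vertices the ordered pairs $(a,b)$ of a vertex $a$ of $K$ and a vertex $b$ of $L$, denoted $a\mathbin{\square}b$. For a vertex $a$ of $K$ and an edge $bc$ of $L$ there is an edge $a\mathbin{\square}bc$ joining $a\mathbin{\square}b$ and $a\mathbin{\square}c$; for an edge $bc$ of $K$ and a vertex $a$ of $L$ there is an edge $bc\mathbin{\square}a$ joining $b\mathbin{\square}a$ and $c\mathbin{\square}a$; there are no other edges. A boundary is the $1$-cycle $ab\mathbin{\square}uv$ in $K\mathbin{\square}L$, where $ab$ is an edge of $K$ and $uv$ an edge of $L$, consisting of the four edges of the cycle with consecutive vertices $a\mathbin{\square}u,\ b\mathbin{\square}u,\ b\mathbin{\square}v,\ a\mathbin{\square}v$.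 Two $1$-cycles $C,C'$ in $K\mathbin{\square}L$ are homologous, written $C\sim C'$, if $C+C'$ is a sum of several boundaries; homology classes are the equivalence classes of this relation. For a $1$-cycle $D$ in $L$ and a vertex $a$ of $K$, the left cycle is $a\mathbin{\square}D=\{a\mathbin{\square}\sigma:\sigma\in D\}$. For a $1$-cycle $D$ in $K$ and a vertex $b$ of $L$, the right cycle is $D\mathbin{\square}b=\{\sigma\mathbin{\square}b:\sigma\in D\}$. For a $1$-cycle $C$ in $K\mathbin{\square}L$, the left projection $C_y$ is the set of all edges $\sigma$ of $L$ such that the number of vertices $a$ of $K$ with $a\mathbin{\square}\sigma\in C$ is odd; the right projection $C_x$ is the set of all edges $\sigma$ of $K$ such that the number of vertices $b$ of $L$ with $\sigma\mathbin{\square}b\in C$ is odd. *)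

theory Defs
  imports Main
begin

record 'a ugraph =
  verts :: "'a set"
  edges :: "'a set set"

definition simple_graph :: "'a ugraph \<Rightarrow> bool" where
  "simple_graph G \<longleftrightarrow>
     finite (verts G) \<and>
     (\<forall>e \<in> edges G. \<exists>u \<in> verts G. \<exists>v \<in> verts G. u \<noteq> v \<and> e = {u, v})"

text \<open>The graph without vertices is not regarded as connected.\<close>

definition connected_graph :: "'a ugraph \<Rightarrow> bool" where
  "connected_graph G \<longleftrightarrow>
     simple_graph G \<and> verts G \<noteq> {} \<and>
     (\<forall>u \<in> verts G. \<forall>v \<in> verts G. (u, v) \<in> {(x, y). {x, y} \<in> edges G}\<^sup>*)"

abbreviation sum2 :: "'a set \<Rightarrow> 'a set \<Rightarrow> 'a set"  (infixl \<open>\<oplus>\<close> 65) where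
  "A \<oplus> B \<equiv> sym_diff A B"

definition sum2_list :: "'a set list \<Rightarrow> 'a set" where
  "sum2_list As = foldr (\<lambda>A S. A \<oplus> S) As {}"

definition one_cycles :: "'a ugraph \<Rightarrow> 'a set set set" where
  "one_cycles G =
     {C. C \<subseteq> edges G \<and> (\<forall>v \<in> verts G. even (card {e \<in> C. v \<in> e}))}"

text \<open>
  For an edge \<open>bc = {b, c}\<close>, the edge of the product joining \<open>(a, b)\<close> and \<open>(a, c)\<close> is
  \<open>{a} \<times> {b, c}\<close>, and the one joining \<open>(b, a)\<close> and \<open>(c, a)\<close> is \<open>{b, c} \<times> {a}\<close>.
\<close>

definition graph_box :: "'a ugraph \<Rightarrow> 'b ugraph \<Rightarrow> ('a \<times> 'b) ugraph"  (infixl \<open>\<box>\<close> 70) where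
  "K \<box> L =
     \<lparr> verts = verts K \<times> verts L,
       edges = {{a} \<times> \<sigma> | a \<sigma>. a \<in> verts K \<and> \<sigma> \<in> edges L} \<union>
               {\<sigma> \<times> {b} | \<sigma> b. \<sigma> \<in> edges K \<and> b \<in> verts L} \<rparr>"

definition left_cycle :: "'a \<Rightarrow> 'b set set \<Rightarrow> ('a \<times> 'b) set set" where
  "left_cycle a D = {{a} \<times> \<sigma> | \<sigma>. \<sigma> \<in> D}"

definition right_cycle :: "'a set set \<Rightarrow> 'b \<Rightarrow> ('a \<times> 'b) set set" where
  "right_cycle D b = {\<sigma> \<times> {b} | \<sigma>. \<sigma> \<in> D}"

definition boundary :: "'a \<Rightarrow> 'a \<Rightarrow> 'b \<Rightarrow> 'b \<Rightarrow> ('a \<times> 'b) set set" where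
  "boundary a b u v =
     {{(a, u), (b, u)}, {(b, u), (b, v)}, {(b, v), (a, v)}, {(a, v), (a, u)}}"

definition boundaries :: "'a ugraph \<Rightarrow> 'b ugraph \<Rightarrow> ('a \<times> 'b) set set set" where
  "boundaries K L =
     {boundary a b u v | a b u v. {a, b} \<in> edges K \<and> {u, v} \<in> edges L}"

definition boundary_sums :: "'a ugraph \<Rightarrow> 'b ugraph \<Rightarrow> ('a \<times> 'b) set set set" where
  "boundary_sums K L = {sum2_list Bs | Bs. set Bs \<subseteq> boundaries K L}"

definition homology :: "'a ugraph \<Rightarrow> 'b ugraph \<Rightarrow> (('a \<times> 'b) set set \<times> ('a \<times> 'b) set set) set" where
  "homology K L =
     {(C, C'). C \<in> one_cycles (K \<box> L) \<and> C' \<in> one_cycles (K \<box> L) \<and>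
               C \<oplus> C' \<in> boundary_sums K L}"

definition left_proj :: "'a ugraph \<Rightarrow> 'b ugraph \<Rightarrow> ('a \<times> 'b) set set \<Rightarrow> 'b set set" where
  "left_proj K L C = {\<sigma> \<in> edges L. odd (card {a \<in> verts K. {a} \<times> \<sigma> \<in> C})}"

definition right_proj :: "'a ugraph \<Rightarrow> 'b ugraph \<Rightarrow> ('a \<times> 'b) set set \<Rightarrow> 'a set set" where
  "right_proj K L C = {\<sigma> \<in> edges K. odd (card {b \<in> verts L. \<sigma> \<times> {b} \<in> C})}"

lemma simple_graph_box:
  assumes "simple_graph K" and "simple_graph L"
  shows "simple_graph (K \<box> L)"
  unfolding simple_graph_def
proof (intro conjI ballI)
  show "finite (verts (K \<box> L))"
    using assms by (simp add: simple_graph_def graph_box_def)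
next
  fix e assume "e \<in> edges (K \<box> L)"
  then consider a \<sigma> where "a \<in> verts K" "\<sigma> \<in> edges L" "e = {a} \<times> \<sigma>"
    | \<sigma> b where "\<sigma> \<in> edges K" "b \<in> verts L" "e = \<sigma> \<times> {b}"
    by (auto simp: graph_box_def)
  then show "\<exists>p \<in> verts (K \<box> L). \<exists>q \<in> verts (K \<box> L). p \<noteq> q \<and> e = {p, q}"
  proof cases
    case 1
    then obtain u v where "u \<in> verts L" "v \<in> verts L" "u \<noteq> v" "\<sigma> = {u, v}"
      using assms(2) unfolding simple_graph_def by blast
    with 1 show ?thesis
      by (intro bexI[of _ "(a, u)"] bexI[of _ "(a, v)"]) (auto simp: graph_box_def)
  next
    case 2
    then obtain u v where "u \<in> verts K" "v \<in> verts K" "u \<noteq> v" "\<sigma> = {u, v}"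
      using assms(1) unfolding simple_graph_def by blast
    with 2 show ?thesis
      by (intro bexI[of _ "(u, b)"] bexI[of _ "(v, b)"]) (auto simp: graph_box_def)
  qed
qed

lemma sum2_list_append: "sum2_list (As @ Bs) = sum2_list As \<oplus> sum2_list Bs"
  by (induction As) (auto simp: sum2_list_def)

lemma equiv_homology: "equiv (one_cycles (K \<box> L)) (homology K L)"
proof (rule equivI)
  show "homology K L \<subseteq> one_cycles (K \<box> L) \<times> one_cycles (K \<box> L)"
    by (auto simp: homology_def)
  have "{} \<in> boundary_sums K L"
    by (auto simp: boundary_sums_def sum2_list_def intro!: exI[of _ "[]"])
  then show "refl_on (one_cycles (K \<box> L)) (homology K L)"
    by (auto simp: refl_on_def homology_def)
  show "sym (homology K L)"
    by (auto simp: sym_def homology_def Un_commute)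
  have "C \<oplus> E \<in> boundary_sums K L"
    if CD: "C \<oplus> D \<in> boundary_sums K L" and DE: "D \<oplus> E \<in> boundary_sums K L" for C D E
  proof -
    obtain As Bs where "C \<oplus> D = sum2_list As" "set As \<subseteq> boundaries K L"
      and "D \<oplus> E = sum2_list Bs" "set Bs \<subseteq> boundaries K L"
      using CD DE unfolding boundary_sums_def by blast
    moreover have "C \<oplus> E = (C \<oplus> D) \<oplus> (D \<oplus> E)" by blast
    ultimately have "C \<oplus> E = sum2_list (As @ Bs)" "set (As @ Bs) \<subseteq> boundaries K L"
      by (simp_all add: sum2_list_append)
    then show ?thesis unfolding boundary_sums_def by blast
  qed
  then show "trans (homology K L)"
    unfolding trans_def homology_def by blast
qed

end

theory Submission
  imports Defs
begin

text \<open>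
  Modulo boundaries, an edge \<open>{x} \<times> \<sigma>\<close> can be pushed along a path of \<open>K\<close> into \<open>{a} \<times> \<sigma>\<close> at the
  cost of edges of the form \<open>\<tau> \<times> {u}\<close>. Hence a cycle \<open>C\<close> is homologous to \<open>a \<box> C\<^sub>y + R\<close> where \<open>R\<close> is
  a cycle all of whose edges have the form \<open>\<tau> \<times> {u}\<close>. Such an \<open>R\<close> splits into right cycles, each of
  which can be pushed along a path of \<open>L\<close> into the layer of \<open>b\<close>, this time at no cost because in a
  cycle the edges swept out cancel. So \<open>R \<sim> R\<^sub>x \<box> b\<close>. As both projections are additive and kill
  boundaries, they are homology invariants; this gives \<open>R\<^sub>x = C\<^sub>x\<close> and uniqueness.
\<close>

section \<open>Symmetric differences and parity\<close>

text \<open>The intersection is counted once in \<open>card A\<close> and once in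
  \<open>card B\<close>, so it drops out modulo 2.\<close>

lemma even_card_sum2:
  assumes "finite A" and "finite B"
  shows "even (card (A \<oplus> B)) \<longleftrightarrow> (even (card A) \<longleftrightarrow> even (card B))"
proof -
  have "card (A \<oplus> B) = card (A - B) + card (B - A)"
    using assms by (intro card_Un_disjoint) auto
  moreover have "card A = card (A - B) + card (A \<inter> B)"
    using assms by (subst card_Un_disjoint[symmetric]) (auto intro: arg_cong[where f = card])
  moreover have "card B = card (B - A) + card (A \<inter> B)"
    using assms by (subst card_Un_disjoint[symmetric]) (auto intro: arg_cong[where f = card])
  ultimately show ?thesis by (simp only: even_add) argo
qed

lemma mem_sum2: "x \<in> A \<oplus> B \<longleftrightarrow> (x \<in> A) \<noteq> (x \<in> B)"
  by blast

lemma inj_image_sum2: "inj f \<Longrightarrow> f ` (A \<oplus> B) = f ` A \<oplus> f ` B"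
  by (simp add: image_Un image_set_diff)

lemma sum2_singletons: "distinct [p, q, r, s] \<Longrightarrow> {p, q, r, s} = {p} \<oplus> {q} \<oplus> {r} \<oplus> {s}"
  by auto

section \<open>Edges and cycles of simple graphs\<close>

lemma simple_graph_edge:
  assumes "simple_graph G" and "e \<in> edges G"
  obtains u v where "u \<in> verts G" "v \<in> verts G" "u \<noteq> v" "e = {u, v}"
  using assms unfolding simple_graph_def by blast

lemma simple_graph_finite_edges: "simple_graph G \<Longrightarrow> finite (edges G)"
  unfolding simple_graph_def by (rule finite_subset[of _ "Pow (verts G)"]) auto

lemma one_cycles_subset: "C \<in> one_cycles G \<Longrightarrow> C \<subseteq> edges G"
  by (simp add: one_cycles_def)

lemma empty_one_cycle: "{} \<in> one_cycles G"
  by (simp add: one_cycles_def)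

lemma one_cycles_sum2:
  assumes "simple_graph G" and "C \<in> one_cycles G" and "D \<in> one_cycles G"
  shows "C \<oplus> D \<in> one_cycles G"
proof -
  have "finite C" "finite D"
    using assms simple_graph_finite_edges one_cycles_subset finite_subset by metis+
  moreover have "{e \<in> C \<oplus> D. v \<in> e} = {e \<in> C. v \<in> e} \<oplus> {e \<in> D. v \<in> e}" for v
    by blast
  ultimately show ?thesis
    using assms(2,3) by (auto simp: one_cycles_def even_card_sum2)
qed

section \<open>Sums of boundaries\<close>

lemma empty_boundary_sum: "{} \<in> boundary_sums K L"
  by (auto simp: boundary_sums_def sum2_list_def intro!: exI[of _ "[]"])

lemma boundary_sums_sum2:
  assumes "A \<in> boundary_sums K L" and "B \<in> boundary_sums K L"
  shows "A \<oplus> B \<in> boundary_sums K L"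
proof -
  obtain As Bs where "A = sum2_list As" "set As \<subseteq> boundaries K L"
    and "B = sum2_list Bs" "set Bs \<subseteq> boundaries K L"
    using assms unfolding boundary_sums_def by blast
  then have "A \<oplus> B = sum2_list (As @ Bs)" "set (As @ Bs) \<subseteq> boundaries K L"
    by (simp_all add: sum2_list_append)
  then show ?thesis unfolding boundary_sums_def by blast
qed

lemma boundary_sums_boundary:
  assumes "{a, b} \<in> edges K" and "{u, v} \<in> edges L"
  shows "boundary a b u v \<in> boundary_sums K L"
proof -
  have "boundary a b u v = sum2_list [boundary a b u v]"
    by (simp add: sum2_list_def)
  then show ?thesis
    using assms unfolding boundary_sums_def boundaries_def by fastforce
qed

text \<open>Each edge is rewritten as a product of a vertex and an edge, the shape used by
  \<open>graph_box\<close> and by the projections.\<close>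

lemma boundary_eq_edges:
  "boundary a b u v = {{a} \<times> {u, v}, {b} \<times> {u, v}, {a, b} \<times> {u}, {a, b} \<times> {v}}"
  unfolding boundary_def by (auto simp: insert_commute)

text \<open>Induction on the list of summands; it reduces claims about boundary sums to adding a
  single boundary.\<close>

lemma boundary_sums_induct [consumes 1, case_names empty step]:
  assumes "B \<in> boundary_sums K L" and "P {}"
    and step: "\<And>a b u v B. {a, b} \<in> edges K \<Longrightarrow> {u, v} \<in> edges L \<Longrightarrow> P B \<Longrightarrow> P (boundary a b u v \<oplus> B)"
  shows "P B"
proof -
  obtain Bs where Bs: "B = sum2_list Bs" "set Bs \<subseteq> boundaries K L"
    using assms(1) unfolding boundary_sums_def by blast
  have "P (sum2_list Bs)"
    using Bs(2)
  proof (induction Bs)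
    case Nil
    then show ?case using assms(2) by (simp add: sum2_list_def)
  next
    case (Cons A As)
    then obtain a b u v where "A = boundary a b u v" "{a, b} \<in> edges K" "{u, v} \<in> edges L"
      by (auto simp: boundaries_def)
    then show ?case
      using step[of a b u v "sum2_list As"] Cons by (simp add: sum2_list_def)
  qed
  with Bs(1) show ?thesis by simp
qed

lemma homology_iff:
  "(C, C') \<in> homology K L \<longleftrightarrow>
     C \<in> one_cycles (K \<box> L) \<and> C' \<in> one_cycles (K \<box> L) \<and> C \<oplus> C' \<in> boundary_sums K L"
  by (simp add: homology_def)

section \<open>Left and right edges of the product\<close>

locale two_simple_graphs =
  fixes K :: "'a ugraph" and L :: "'b ugraph"
  assumes simple_K: "simple_graph K" and simple_L: "simple_graph L"
begin

lemma finite_verts: "finite (verts K)" "finite (verts L)"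
  using simple_K simple_L by (simp_all add: simple_graph_def)

lemma simple_box: "simple_graph (K \<box> L)"
  using simple_graph_box simple_K simple_L .

text \<open>The points of a left edge have two different second coordinates, those of
  \<open>\<tau> \<times> {u}\<close> only one. Hence the two kinds of edges never mix.\<close>

lemma left_edge_neq_right_edge:
  assumes "\<sigma> \<in> edges L" shows "{x} \<times> \<sigma> \<noteq> \<tau> \<times> {u}"
proof
  assume *: "{x} \<times> \<sigma> = \<tau> \<times> {u}"
  obtain v w where "v \<noteq> w" "\<sigma> = {v, w}"
    using simple_graph_edge[OF simple_L assms] by metis
  with * have "(x, v) \<in> \<tau> \<times> {u}" "(x, w) \<in> \<tau> \<times> {u}" by blast+
  with \<open>v \<noteq> w\<close> show False by simp
qed

lemma right_edge_eq_iff: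
  assumes "\<tau> \<in> edges K" shows "\<tau> \<times> {u} = \<tau>' \<times> {u'} \<longleftrightarrow> \<tau> = \<tau>' \<and> u = u'"
  using simple_graph_edge[OF simple_K assms] by (auto simp: times_eq_iff)

lemma left_edge_eq_iff:
  assumes "\<sigma> \<in> edges L" shows "{x} \<times> \<sigma> = {x'} \<times> \<sigma>' \<longleftrightarrow> \<sigma> = \<sigma>' \<and> x = x'"
  using simple_graph_edge[OF simple_L assms] by (auto simp: times_eq_iff)

lemma box_edge_cases [consumes 1, case_names left right]:
  assumes "e \<in> edges (K \<box> L)"
  obtains x \<sigma> where "x \<in> verts K" "\<sigma> \<in> edges L" "e = {x} \<times> \<sigma>"
    | \<tau> u where "\<tau> \<in> edges K" "u \<in> verts L" "e = \<tau> \<times> {u}"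
  using assms by (auto simp: graph_box_def)

text \<open>As \<open>a \<noteq> b\<close> and \<open>u \<noteq> v\<close>, the four edges are
  distinct, so listing them amounts to adding them. In this form additive maps apply to a boundary
  edge by edge.\<close>

lemma boundary_eq_sum2:
  assumes "{a, b} \<in> edges K" and "{u, v} \<in> edges L"
  shows "boundary a b u v =
    {{a} \<times> {u, v}} \<oplus> {{b} \<times> {u, v}} \<oplus> {{a, b} \<times> {u}} \<oplus> {{a, b} \<times> {v}}"
proof -
  have "a \<noteq> b" "u \<noteq> v"
    using simple_graph_edge[OF simple_K assms(1)] simple_graph_edge[OF simple_L assms(2)]
    by (metis doubleton_eq_iff)+
  have "distinct [{a} \<times> {u, v}, {b} \<times> {u, v}, {a, b} \<times> {u}, {a, b} \<times> {v}]"
    using \<open>a \<noteq> b\<close> \<open>u \<noteq> v\<close>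
    by (simp only: distinct.simps list.set insert_iff empty_iff left_edge_eq_iff[OF assms(2)]
        right_edge_eq_iff[OF assms(1)] left_edge_neq_right_edge[OF assms(2)]) simp
  then show ?thesis by (simp only: boundary_eq_edges sum2_singletons)
qed

section \<open>Additivity of the projections and their values on layers\<close>

text \<open>Over each \<open>\<sigma>\<close> the set of counted vertices is additive, hence so is
  its parity. Since \<open>X\<close> and \<open>Y\<close> are arbitrary sets, later arguments can
  proceed one edge at a time.\<close>

lemma left_proj_sum2: "left_proj K L (X \<oplus> Y) = left_proj K L X \<oplus> left_proj K L Y"
proof -
  have "{a \<in> verts K. {a} \<times> \<sigma> \<in> X \<oplus> Y} =
      {a \<in> verts K. {a} \<times> \<sigma> \<in> X} \<oplus> {a \<in> verts K. {a} \<times> \<sigma> \<in> Y}" for \<sigma> :: "'b set"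
    by blast
  then show ?thesis
    using finite_verts unfolding left_proj_def by (auto simp: even_card_sum2)
qed

lemma right_proj_sum2: "right_proj K L (X \<oplus> Y) = right_proj K L X \<oplus> right_proj K L Y"
proof -
  have "{b \<in> verts L. \<sigma> \<times> {b} \<in> X \<oplus> Y} =
      {b \<in> verts L. \<sigma> \<times> {b} \<in> X} \<oplus> {b \<in> verts L. \<sigma> \<times> {b} \<in> Y}" for \<sigma> :: "'a set"
    by blast
  then show ?thesis
    using finite_verts unfolding right_proj_def by (auto simp: even_card_sum2)
qed

lemma left_proj_left_cycle:
  assumes "D \<subseteq> edges L" and "a \<in> verts K"
  shows "left_proj K L (left_cycle a D) = D"
proof -
  have "{x \<in> verts K. {x} \<times> \<sigma> \<in> left_cycle a D} = (if \<sigma> \<in> D then {a} else {})"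
    if "\<sigma> \<in> edges L" for \<sigma>
    using that assms by (auto simp: left_cycle_def left_edge_eq_iff)
  then show ?thesis using assms unfolding left_proj_def by (auto split: if_splits)
qed

lemma right_proj_right_cycle:
  assumes "D \<subseteq> edges K" and "b \<in> verts L"
  shows "right_proj K L (right_cycle D b) = D"
proof -
  have "{x \<in> verts L. \<sigma> \<times> {x} \<in> right_cycle D b} = (if \<sigma> \<in> D then {b} else {})"
    if "\<sigma> \<in> edges K" for \<sigma>
    using that assms by (auto simp: right_cycle_def right_edge_eq_iff)
  then show ?thesis using assms unfolding right_proj_def by (auto split: if_splits)
qed

lemma left_proj_eq_empty:
  assumes "\<And>x \<sigma>. \<sigma> \<in> edges L \<Longrightarrow> {x} \<times> \<sigma> \<notin> X"
  shows "left_proj K L X = {}"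
  using assms by (simp add: left_proj_def)

lemma left_proj_right_cycle: "left_proj K L (right_cycle D b) = {}"
proof (rule left_proj_eq_empty, rule notI)
  fix x \<sigma> assume "\<sigma> \<in> edges L" "{x} \<times> \<sigma> \<in> right_cycle D b"
  then obtain \<tau> where "{x} \<times> \<sigma> = \<tau> \<times> {b}" unfolding right_cycle_def by blast
  with left_edge_neq_right_edge[OF \<open>\<sigma> \<in> edges L\<close>] show False by metis
qed

lemma right_proj_left_cycle:
  assumes "D \<subseteq> edges L"
  shows "right_proj K L (left_cycle a D) = {}"
proof -
  have "\<tau> \<times> {u} \<notin> left_cycle a D" for \<tau> u
  proof
    assume "\<tau> \<times> {u} \<in> left_cycle a D"
    then obtain \<sigma> where "\<sigma> \<in> D" "\<tau> \<times> {u} = {a} \<times> \<sigma>" unfolding left_cycle_def by blast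
    then show False using left_edge_neq_right_edge assms by (metis subsetD)
  qed
  then show ?thesis by (simp add: right_proj_def)
qed

lemma left_proj_left_edge:
  "\<sigma> \<in> edges L \<Longrightarrow> x \<in> verts K \<Longrightarrow> left_proj K L {{x} \<times> \<sigma>} = {\<sigma>}"
  using left_proj_left_cycle[of "{\<sigma>}" x] by (simp add: left_cycle_def)

lemma right_proj_right_edge:
  "\<tau> \<in> edges K \<Longrightarrow> u \<in> verts L \<Longrightarrow> right_proj K L {\<tau> \<times> {u}} = {\<tau>}"
  using right_proj_right_cycle[of "{\<tau>}" u] by (simp add: right_cycle_def)

lemma left_proj_right_edge: "left_proj K L {\<tau> \<times> {u}} = {}"
  using left_proj_right_cycle[of "{\<tau>}" u] by (simp add: right_cycle_def)

lemma right_proj_left_edge: "\<sigma> \<in> edges L \<Longrightarrow> right_proj K L {{x} \<times> \<sigma>} = {}"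
  using right_proj_left_cycle[of "{\<sigma>}" x] by (simp add: left_cycle_def)

lemma edge_verts:
  "{a, b} \<in> edges K \<Longrightarrow> a \<in> verts K \<and> b \<in> verts K"
  "{u, v} \<in> edges L \<Longrightarrow> u \<in> verts L \<and> v \<in> verts L"
  using simple_K simple_L unfolding simple_graph_def by (metis doubleton_eq_iff)+

section \<open>Homology invariance of the projections\<close>

text \<open>The two left edges of the square have the same left projection and the two right edges
  the same right projection, so each pair cancels; edges of the other kind project to
  nothing.\<close>

lemma proj_boundary:
  assumes "{a, b} \<in> edges K" and "{u, v} \<in> edges L"
  shows "left_proj K L (boundary a b u v) = {}" "right_proj K L (boundary a b u v) = {}"
  using assms edge_verts
  by (simp_all only: boundary_eq_sum2 left_proj_sum2 right_proj_sum2 left_proj_left_edge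
      right_proj_right_edge left_proj_right_edge right_proj_left_edge) auto

lemma proj_boundary_sum:
  assumes "B \<in> boundary_sums K L"
  shows "left_proj K L B = {}" "right_proj K L B = {}"
  using assms
proof (induction rule: boundary_sums_induct)
  case empty
  { case 1 show ?case by (simp add: left_proj_def) }
  { case 2 show ?case by (simp add: right_proj_def) }
next
  case (step a b u v B)
  { case 1 show ?case using step by (simp only: left_proj_sum2 proj_boundary) simp }
  { case 2 show ?case using step by (simp only: right_proj_sum2 proj_boundary) simp }
qed

lemma homologous_proj_eq:
  assumes "(C, C') \<in> homology K L"
  shows "left_proj K L C = left_proj K L C'" "right_proj K L C = right_proj K L C'"
  using proj_boundary_sum[of "C \<oplus> C'"] assms
  by (auto simp: homology_iff left_proj_sum2 right_proj_sum2)

lemma left_proj_layers: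
  assumes "D \<subseteq> edges K" "D' \<subseteq> edges L" "a \<in> verts K"
  shows "left_proj K L (right_cycle D b \<oplus> left_cycle a D') = D'"
  using assms by (simp only: left_proj_sum2 left_proj_right_cycle left_proj_left_cycle) simp

lemma right_proj_layers:
  assumes "D \<subseteq> edges K" "D' \<subseteq> edges L" "b \<in> verts L"
  shows "right_proj K L (right_cycle D b \<oplus> left_cycle a D') = D"
  using assms by (simp only: right_proj_sum2 right_proj_right_cycle right_proj_left_cycle) simp

section \<open>Layers and left projections of cycles are cycles\<close>

text \<open>At a vertex \<open>(a, v)\<close> the edges correspond one to one to the edges of
  \<open>D\<close> at \<open>v\<close>; over every other vertex of \<open>K\<close> there are
  none.\<close>

lemma left_cycle_one_cycle:
  assumes "a \<in> verts K" and "D \<in> one_cycles L"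
  shows "left_cycle a D \<in> one_cycles (K \<box> L)"
proof -
  have "even (card {e \<in> left_cycle a D. (x, v) \<in> e})" if "v \<in> verts L" for x v
  proof -
    have "{e \<in> left_cycle a D. (x, v) \<in> e} =
        (if x = a then (\<lambda>\<sigma>. {a} \<times> \<sigma>) ` {\<sigma> \<in> D. v \<in> \<sigma>} else {})"
      by (auto simp: left_cycle_def)
    moreover have "card ((\<lambda>\<sigma>. {a} \<times> \<sigma>) ` {\<sigma> \<in> D. v \<in> \<sigma>}) = card {\<sigma> \<in> D. v \<in> \<sigma>}"
      by (intro card_image) (auto simp: inj_on_def times_eq_iff)
    ultimately show ?thesis using assms that by (simp add: one_cycles_def)
  qed
  moreover have "left_cycle a D \<subseteq> edges (K \<box> L)"
    using assms one_cycles_subset unfolding graph_box_def left_cycle_def by fastforce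
  ultimately show ?thesis by (auto simp: one_cycles_def graph_box_def)
qed

text \<open>Stated for an arbitrary \<open>D\<close>, because it also serves to show that the layers
  of a cycle of right edges are cycles.\<close>

lemma card_right_edges_at:
  "card {e \<in> right_cycle D b. (x, v) \<in> e} = (if v = b then card {\<tau> \<in> D. x \<in> \<tau>} else 0)"
proof -
  have "{e \<in> right_cycle D b. (x, v) \<in> e} =
      (if v = b then (\<lambda>\<tau>. \<tau> \<times> {b}) ` {\<tau> \<in> D. x \<in> \<tau>} else {})"
    by (auto simp: right_cycle_def)
  moreover have "card ((\<lambda>\<tau>. \<tau> \<times> {b}) ` {\<tau> \<in> D. x \<in> \<tau>}) = card {\<tau> \<in> D. x \<in> \<tau>}"
    by (intro card_image) (auto simp: inj_on_def times_eq_iff)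
  ultimately show ?thesis by simp
qed

lemma right_cycle_one_cycle:
  assumes "b \<in> verts L" and "D \<in> one_cycles K"
  shows "right_cycle D b \<in> one_cycles (K \<box> L)"
proof -
  have "right_cycle D b \<subseteq> edges (K \<box> L)"
    using assms by (auto simp: one_cycles_def graph_box_def right_cycle_def)
  then show ?thesis
    using assms by (auto simp: one_cycles_def card_right_edges_at graph_box_def)
qed

lemma layers_one_cycle:
  assumes "a \<in> verts K" "b \<in> verts L" "D \<in> one_cycles K" "D' \<in> one_cycles L"
  shows "right_cycle D b \<oplus> left_cycle a D' \<in> one_cycles (K \<box> L)"
  using assms by (intro one_cycles_sum2 simple_box right_cycle_one_cycle left_cycle_one_cycle)

text \<open>An edge \<open>\<tau> \<times> {v}\<close> has both its ends over \<open>v\<close>, so it does not affect the parity of the sum.\<close>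

lemma odd_degree_left_proj:
  assumes "X \<subseteq> edges (K \<box> L)"
  shows "odd (card {\<sigma> \<in> left_proj K L X. v \<in> \<sigma>}) \<longleftrightarrow>
    odd (\<Sum>x \<in> verts K. card {e \<in> X. (x, v) \<in> e})"
proof -
  have "finite X"
    using assms simple_graph_finite_edges[OF simple_box] finite_subset by blast
  then show ?thesis
    using assms
  proof (induction X)
    case empty
    then show ?case by (simp add: left_proj_def)
  next
    case (insert e X)
    have fin: "finite (left_proj K L Y)" for Y
      using simple_graph_finite_edges[OF simple_L] by (simp add: left_proj_def)
    have "left_proj K L (insert e X) = left_proj K L ({e} \<oplus> X)"
      using insert.hyps by (intro arg_cong[where f = "left_proj K L"]) auto
    then have "{\<sigma> \<in> left_proj K L (insert e X). v \<in> \<sigma>} =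
        {\<sigma> \<in> left_proj K L {e}. v \<in> \<sigma>} \<oplus> {\<sigma> \<in> left_proj K L X. v \<in> \<sigma>}"
      by (auto simp: left_proj_sum2)
    then have 1: "odd (card {\<sigma> \<in> left_proj K L (insert e X). v \<in> \<sigma>}) \<longleftrightarrow>
        odd (card {\<sigma> \<in> left_proj K L {e}. v \<in> \<sigma>}) \<noteq> odd (card {\<sigma> \<in> left_proj K L X. v \<in> \<sigma>})"
      using fin by (simp add: even_card_sum2)
    have "{e' \<in> insert e X. (x, v) \<in> e'} =
        (if (x, v) \<in> e then insert e {e' \<in> X. (x, v) \<in> e'} else {e' \<in> X. (x, v) \<in> e'})" for x
      by auto
    then have "card {e' \<in> insert e X. (x, v) \<in> e'} =
        (if (x, v) \<in> e then 1 else 0) + card {e' \<in> X. (x, v) \<in> e'}" for x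
      using insert.hyps by simp
    \<comment> \<open>Adding \<open>e\<close> raises the degree by one at each of its ends over
      \<open>v\<close>.\<close>
    then have 2: "(\<Sum>x \<in> verts K. card {e' \<in> insert e X. (x, v) \<in> e'}) =
        card {x \<in> verts K. (x, v) \<in> e} + (\<Sum>x \<in> verts K. card {e' \<in> X. (x, v) \<in> e'})"
      using finite_verts by (simp add: sum.distrib sum.If_cases Int_def)
    have 3: "odd (card {\<sigma> \<in> left_proj K L {e}. v \<in> \<sigma>}) \<longleftrightarrow> odd (card {x \<in> verts K. (x, v) \<in> e})"
    proof -
      have "e \<in> edges (K \<box> L)" using insert.prems by simp
      then show ?thesis
      proof (cases rule: box_edge_cases)
        case (left x \<sigma>)
        then have "{x' \<in> verts K. (x', v) \<in> e} = (if v \<in> \<sigma> then {x} else {})"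
          and "{\<sigma>' \<in> left_proj K L {e}. v \<in> \<sigma>'} = (if v \<in> \<sigma> then {\<sigma>} else {})"
          by (auto simp: left_proj_left_edge)
        then show ?thesis by simp
      next
        case (right \<tau> u)
        obtain p q where "p \<in> verts K" "q \<in> verts K" "p \<noteq> q" "\<tau> = {p, q}"
          using simple_graph_edge[OF simple_K right(1)] .
        with right have "{x' \<in> verts K. (x', v) \<in> e} = (if v = u then {p, q} else {})"
          by auto
        with \<open>p \<noteq> q\<close> right(3) show ?thesis by (simp add: left_proj_right_edge)
      qed
    qed
    have "odd (card {\<sigma> \<in> left_proj K L X. v \<in> \<sigma>}) \<longleftrightarrow>
        odd (\<Sum>x \<in> verts K. card {e \<in> X. (x, v) \<in> e})"
      using insert by simp
    then show ?case unfolding 1 2 3 by simp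
  qed
qed

text \<open>The degree of \<open>v\<close> in the projection has the parity of the sum of the
  degrees of \<open>C\<close> at all vertices over \<open>v\<close>, and each of these is
  even.\<close>

lemma left_proj_one_cycle:
  assumes "C \<in> one_cycles (K \<box> L)"
  shows "left_proj K L C \<in> one_cycles L"
proof -
  have "even (card {\<sigma> \<in> left_proj K L C. v \<in> \<sigma>})" if "v \<in> verts L" for v
  proof -
    have "even (\<Sum>x \<in> verts K. card {e \<in> C. (x, v) \<in> e})"
      using assms that by (intro dvd_sum) (auto simp: one_cycles_def graph_box_def)
    then show ?thesis
      using odd_degree_left_proj[OF one_cycles_subset[OF assms]] by blast
  qed
  then show ?thesis by (auto simp: one_cycles_def left_proj_def)
qed

section \<open>Pushing left edges into the layer of one vertex\<close>

text \<open>These edges form the remainder when left edges are pushed into one layer.\<close>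

definition right_edges :: "('a \<times> 'b) set set" where
  "right_edges = {\<tau> \<times> {u} | \<tau> u. \<tau> \<in> edges K \<and> u \<in> verts L}"

text \<open>For an edge \<open>{y, z}\<close> of the path, the boundary over \<open>{y, z}\<close>
  and \<open>\<sigma>\<close> trades \<open>{y} \<times> \<sigma>\<close> for
  \<open>{z} \<times> \<sigma>\<close> and leaves two right edges; \<open>R\<close> collects them
  modulo 2.\<close>

lemma push_left_edge:
  assumes "\<sigma> \<in> edges L" and "(x, a) \<in> {(x, y). {x, y} \<in> edges K}\<^sup>*"
  shows "\<exists>R \<subseteq> right_edges. {{x} \<times> \<sigma>} \<oplus> {{a} \<times> \<sigma>} \<oplus> R \<in> boundary_sums K L"
  using assms(2)
proof (induction rule: rtrancl_induct)
  case base
  show ?case by (rule exI[of _ "{}"]) (simp add: empty_boundary_sum)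
next
  case (step y z)
  then obtain R where R: "R \<subseteq> right_edges" "{{x} \<times> \<sigma>} \<oplus> {{y} \<times> \<sigma>} \<oplus> R \<in> boundary_sums K L"
    by blast
  obtain u v where uv: "u \<in> verts L" "v \<in> verts L" "\<sigma> = {u, v}"
    using simple_graph_edge[OF simple_L assms(1)] by metis
  have yz: "{y, z} \<in> edges K" using step by simp
  let ?S = "{{y, z} \<times> {u}} \<oplus> {{y, z} \<times> {v}}"
  have "boundary y z u v = {{y} \<times> \<sigma>} \<oplus> {{z} \<times> \<sigma>} \<oplus> ?S"
    using boundary_eq_sum2[OF yz] assms(1) unfolding uv(3)
    by (intro set_eqI) (simp only: mem_sum2, argo)
  then have "{{y} \<times> \<sigma>} \<oplus> {{z} \<times> \<sigma>} \<oplus> ?S \<in> boundary_sums K L"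
    using boundary_sums_boundary[OF yz] assms(1) uv(3) by metis
  from boundary_sums_sum2[OF R(2) this]
  have "{{x} \<times> \<sigma>} \<oplus> {{z} \<times> \<sigma>} \<oplus> (R \<oplus> ?S) \<in> boundary_sums K L"
    by (rule back_subst[where P = "\<lambda>A. A \<in> boundary_sums K L"])
      (intro set_eqI, simp only: mem_sum2, argo)
  moreover have "R \<oplus> ?S \<subseteq> right_edges"
    using R(1) yz uv unfolding right_edges_def by blast
  ultimately show ?case by blast
qed

text \<open>All terms are additive in \<open>X\<close>, so single edges suffice: a left edge is
  pushed along a path to \<open>a\<close>, which exists by connectedness, and a right edge is its
  own remainder.\<close>

lemma push_left_edges:
  assumes "connected_graph K" and "a \<in> verts K" and "X \<subseteq> edges (K \<box> L)"
  shows "\<exists>R \<subseteq> right_edges. X \<oplus> left_cycle a (left_proj K L X) \<oplus> R \<in> boundary_sums K L"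
proof -
  have "finite X"
    using assms(3) simple_graph_finite_edges[OF simple_box] finite_subset by blast
  then show ?thesis
    using assms(3)
  proof (induction X)
    case empty
    show ?case
      by (rule exI[of _ "{}"]) (simp add: empty_boundary_sum left_proj_def left_cycle_def)
  next
    case (insert e X)
    then obtain R where R: "R \<subseteq> right_edges"
      "X \<oplus> left_cycle a (left_proj K L X) \<oplus> R \<in> boundary_sums K L"
      by auto
    have ins: "insert e X = {e} \<oplus> X" using insert.hyps by auto
    have "e \<in> edges (K \<box> L)" using insert.prems by simp
    then have "\<exists>R' \<subseteq> right_edges. {e} \<oplus> left_cycle a (left_proj K L {e}) \<oplus> R' \<in> boundary_sums K L"
    proof (cases rule: box_edge_cases)
      case (left x \<sigma>)
      have "(x, a) \<in> {(x, y). {x, y} \<in> edges K}\<^sup>*"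
        using assms left(1) unfolding connected_graph_def by blast
      from push_left_edge[OF left(2) this] show ?thesis
        using left by (simp add: left_proj_left_edge left_cycle_def)
    next
      case (right \<tau> u)
      then have "{e} \<subseteq> right_edges" by (auto simp: right_edges_def)
      moreover have "{e} \<oplus> left_cycle a (left_proj K L {e}) \<oplus> {e} \<in> boundary_sums K L"
        using right by (simp add: left_proj_right_edge left_cycle_def empty_boundary_sum)
      ultimately show ?thesis by blast
    qed
    then obtain R' where R': "R' \<subseteq> right_edges"
      "{e} \<oplus> left_cycle a (left_proj K L {e}) \<oplus> R' \<in> boundary_sums K L" by blast
    \<comment> \<open>\<open>left_cycle a\<close> is additive because
      \<open>\<lambda>\<sigma>. {a} \<times> \<sigma>\<close> is injective.\<close>
    have "left_cycle a (left_proj K L ({e} \<oplus> X)) =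
        left_cycle a (left_proj K L {e}) \<oplus> left_cycle a (left_proj K L X)"
      unfolding left_proj_sum2 left_cycle_def by (auto simp: times_eq_iff)
    then have "{e} \<oplus> X \<oplus> left_cycle a (left_proj K L ({e} \<oplus> X)) \<oplus> (R' \<oplus> R) =
        ({e} \<oplus> left_cycle a (left_proj K L {e}) \<oplus> R') \<oplus> (X \<oplus> left_cycle a (left_proj K L X) \<oplus> R)"
      by (intro set_eqI) (simp only: mem_sum2, argo)
    then have "insert e X \<oplus> left_cycle a (left_proj K L (insert e X)) \<oplus> (R' \<oplus> R) \<in> boundary_sums K L"
      using boundary_sums_sum2[OF R'(2) R(2)] unfolding ins by simp
    moreover have "R' \<oplus> R \<subseteq> right_edges" using R R' by blast
    ultimately show ?case by blast
  qed
qed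

section \<open>Pushing right cycles into the layer of one vertex\<close>

text \<open>When the boundaries over all \<open>\<tau> \<in> X\<close> are added, the rung
  \<open>{x} \<times> {v, w}\<close> occurs once for every edge of \<open>X\<close> at
  \<open>x\<close>, so it survives exactly where the degree is odd.\<close>

lemma sweep_right_edges:
  assumes "X \<subseteq> edges K" and "{v, w} \<in> edges L"
  shows "right_cycle X v \<oplus> right_cycle X w \<oplus> (\<lambda>x. {x} \<times> {v, w}) ` {x. odd (card {\<tau> \<in> X. x \<in> \<tau>})}
    \<in> boundary_sums K L"
proof -
  have "finite X"
    using assms(1) simple_graph_finite_edges[OF simple_K] finite_subset by blast
  then show ?thesis
    using assms(1)
  proof (induction X)
    case empty
    then show ?case by (simp add: right_cycle_def empty_boundary_sum)
  next
    case (insert \<tau> X)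
    let ?O = "\<lambda>X. (\<lambda>x. {x} \<times> {v, w}) ` {x. odd (card {\<tau> \<in> X. x \<in> \<tau>})}"
    have \<tau>: "\<tau> \<in> edges K" using insert.prems by simp
    obtain p q where pq: "p \<noteq> q" "\<tau> = {p, q}"
      using simple_graph_edge[OF simple_K \<tau>] by metis
    have ins: "insert \<tau> X = {\<tau>} \<oplus> X" using insert.hyps by auto
    have "{\<tau>' \<in> {\<tau>} \<oplus> X. x \<in> \<tau>'} = {\<tau>' \<in> {\<tau>}. x \<in> \<tau>'} \<oplus> {\<tau>' \<in> X. x \<in> \<tau>'}" for x by blast
    then have odd_iff: "odd (card {\<tau>' \<in> {\<tau>} \<oplus> X. x \<in> \<tau>'}) \<longleftrightarrow>
        (x \<in> \<tau>) \<noteq> odd (card {\<tau> \<in> X. x \<in> \<tau>})" for x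
      using insert.hyps by (cases "x \<in> \<tau>") (simp_all add: even_card_sum2 conj_commute Collect_conv_if)
    have inj: "inj (\<lambda>x :: 'a. {x} \<times> {v, w})" by (auto simp: inj_def times_eq_iff)
    \<comment> \<open>Adding the edge \<open>{p, q}\<close> flips the parity of the degree at
      \<open>p\<close> and at \<open>q\<close> only.\<close>
    have "{x. (x \<in> \<tau>) \<noteq> odd (card {\<tau> \<in> X. x \<in> \<tau>})} =
        {p} \<oplus> {q} \<oplus> {x. odd (card {\<tau> \<in> X. x \<in> \<tau>})}"
      using pq by auto
    then have O: "?O ({\<tau>} \<oplus> X) = {{p} \<times> {v, w}} \<oplus> {{q} \<times> {v, w}} \<oplus> ?O X"
      unfolding odd_iff by (simp only: inj_image_sum2[OF inj] image_insert image_empty)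
    have cyc: "right_cycle ({\<tau>} \<oplus> X) y = {\<tau> \<times> {y}} \<oplus> right_cycle X y" for y :: 'b
      by (auto simp: right_cycle_def times_eq_iff)
    have "right_cycle ({\<tau>} \<oplus> X) v \<oplus> right_cycle ({\<tau>} \<oplus> X) w \<oplus> ?O ({\<tau>} \<oplus> X) =
        boundary p q v w \<oplus> (right_cycle X v \<oplus> right_cycle X w \<oplus> ?O X)"
      unfolding O cyc boundary_eq_sum2[OF \<tau>[unfolded pq(2)] assms(2), folded pq(2)]
      by (intro set_eqI) (simp only: mem_sum2, argo)
    also have "\<dots> \<in> boundary_sums K L"
    proof (rule boundary_sums_sum2)
      show "boundary p q v w \<in> boundary_sums K L"
        using boundary_sums_boundary[OF \<tau>[unfolded pq(2)] assms(2)] .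
      show "right_cycle X v \<oplus> right_cycle X w \<oplus> ?O X \<in> boundary_sums K L"
        using insert by simp
    qed
    finally show ?case unfolding ins .
  qed
qed

text \<open>By induction along the path: between adjacent vertices of \<open>L\<close> the sweep of
  a cycle leaves no rungs, because all degrees are even.\<close>

lemma push_right_cycle:
  assumes "D \<in> one_cycles K" and "(v, b) \<in> {(x, y). {x, y} \<in> edges L}\<^sup>*"
  shows "right_cycle D v \<oplus> right_cycle D b \<in> boundary_sums K L"
  using assms(2)
proof (induction rule: rtrancl_induct)
  case base
  show ?case by (simp add: empty_boundary_sum)
next
  case (step y z)
  \<comment> \<open>\<open>sweep_right_edges\<close> takes parities at every \<open>x\<close> of the
    type; outside \<open>verts K\<close> the degree is zero.\<close>
  have "even (card {\<tau> \<in> D. x \<in> \<tau>})" for x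
  proof (cases "x \<in> verts K")
    case True
    then show ?thesis using assms(1) by (simp add: one_cycles_def)
  next
    case False
    then have "x \<notin> \<tau>" if "\<tau> \<in> D" for \<tau>
      using simple_graph_edge[OF simple_K, of \<tau>] one_cycles_subset[OF assms(1)] that by blast
    then have "{\<tau> \<in> D. x \<in> \<tau>} = {}" by blast
    then show ?thesis by (metis card.empty even_zero)
  qed
  then have "right_cycle D y \<oplus> right_cycle D z \<in> boundary_sums K L"
    using sweep_right_edges[OF one_cycles_subset[OF assms(1)], of y z] step by simp
  from boundary_sums_sum2[OF step.IH this] show ?case
    by (rule back_subst[where P = "\<lambda>A. A \<in> boundary_sums K L"])
      (intro set_eqI, simp only: mem_sum2, argo)
qed

text \<open>The edges of \<open>R\<close> at \<open>(x, u)\<close> all lie over \<open>u\<close>, so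
  each layer of \<open>R\<close> is a cycle of \<open>K\<close> and can be pushed to
  \<open>b\<close> along a path of \<open>L\<close>. Modulo 2 the layers add up to
  \<open>right_proj K L R\<close>, which is therefore a cycle too.\<close>

lemma collapse_right_edges:
  assumes "connected_graph L" and "b \<in> verts L" and "R \<subseteq> right_edges"
    and "R \<in> one_cycles (K \<box> L)"
  shows "right_proj K L R \<in> one_cycles K"
    and "R \<oplus> right_cycle (right_proj K L R) b \<in> boundary_sums K L"
proof -
  \<comment> \<open>\<open>layer u\<close> is the part of \<open>R\<close> over \<open>u\<close>;
    \<open>proj V\<close> and \<open>part V\<close> restrict the right projection and
    \<open>R\<close> itself to the vertices in \<open>V\<close>, so that induction on
    \<open>V\<close> adds one layer at a time.\<close>
  define layer where "layer u = {\<tau> \<in> edges K. \<tau> \<times> {u} \<in> R}" for u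
  define proj where "proj V = {\<tau> \<in> edges K. odd (card {u \<in> V. \<tau> \<times> {u} \<in> R})}" for V
  define part where "part V = (\<Union>u\<in>V. right_cycle (layer u) u)" for V
  have R: "R = part (verts L)"
    using assms(3) by (fastforce simp: part_def layer_def right_cycle_def right_edges_def)
  have layer: "layer u \<in> one_cycles K" if "u \<in> verts L" for u
  proof -
    have "{e \<in> R. (x, u) \<in> e} = {e \<in> right_cycle (layer u) u. (x, u) \<in> e}" for x
      using R that by (auto simp: part_def right_cycle_def)
    then have "card {\<tau> \<in> layer u. x \<in> \<tau>} = card {e \<in> R. (x, u) \<in> e}" for x
      by (simp add: card_right_edges_at)
    then show ?thesis
      using assms(4) that by (auto simp: one_cycles_def graph_box_def layer_def)
  qed
  have "proj V \<in> one_cycles K \<and> part V \<oplus> right_cycle (proj V) b \<in> boundary_sums K L"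
    if "V \<subseteq> verts L" for V
    using finite_subset[OF that finite_verts(2)] that
  proof (induction V)
    case empty
    show ?case
      by (simp add: proj_def part_def right_cycle_def empty_one_cycle empty_boundary_sum)
  next
    case (insert u V)
    then have u: "u \<in> verts L"
      and IH: "proj V \<in> one_cycles K" "part V \<oplus> right_cycle (proj V) b \<in> boundary_sums K L"
      by auto
    have "{u' \<in> insert u V. \<tau> \<times> {u'} \<in> R} =
        (if \<tau> \<times> {u} \<in> R then insert u {u' \<in> V. \<tau> \<times> {u'} \<in> R} else {u' \<in> V. \<tau> \<times> {u'} \<in> R})" for \<tau>
      by auto
    then have proj: "proj (insert u V) = layer u \<oplus> proj V"
      using insert.hyps by (auto simp: proj_def layer_def)
    \<comment> \<open>Layers over different vertices share no edge, so their union is their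
      sum.\<close>
    have "right_cycle (layer u) u \<inter> part V = {}"
      using insert.hyps by (auto simp: part_def right_cycle_def layer_def right_edge_eq_iff)
    then have part: "part (insert u V) = right_cycle (layer u) u \<oplus> part V"
      by (auto simp: part_def)
    have "(u, b) \<in> {(x, y). {x, y} \<in> edges L}\<^sup>*"
      using assms(1,2) u unfolding connected_graph_def by blast
    from push_right_cycle[OF layer[OF u] this]
    have "right_cycle (layer u) u \<oplus> right_cycle (layer u) b \<in> boundary_sums K L" .
    moreover have "right_cycle (layer u \<oplus> proj V) b =
        right_cycle (layer u) b \<oplus> right_cycle (proj V) b"
      by (auto simp: right_cycle_def times_eq_iff)
    then have "part (insert u V) \<oplus> right_cycle (proj (insert u V)) b =
        (right_cycle (layer u) u \<oplus> right_cycle (layer u) b) \<oplus> (part V \<oplus> right_cycle (proj V) b)"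
      unfolding part proj by (intro set_eqI) (simp only: mem_sum2, argo)
    ultimately have "part (insert u V) \<oplus> right_cycle (proj (insert u V)) b \<in> boundary_sums K L"
      using boundary_sums_sum2 IH(2) by metis
    moreover have "proj (insert u V) \<in> one_cycles K"
      unfolding proj using one_cycles_sum2[OF simple_K layer[OF u] IH(1)] .
    ultimately show ?case by blast
  qed
  from this[of "verts L"]
  show "right_proj K L R \<in> one_cycles K"
    and "R \<oplus> right_cycle (right_proj K L R) b \<in> boundary_sums K L"
    using R by (simp_all add: proj_def right_proj_def)
qed

section \<open>Homology classes and their representatives by two layers\<close>

text \<open>Each vertex of the square lies on exactly one left and one right edge of it. This is
  used to see that the remainder after pushing left edges is a cycle.\<close>

lemma boundary_sum_one_cycle:
  assumes "B \<in> boundary_sums K L" 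
  shows "B \<in> one_cycles (K \<box> L)"
  using assms
proof (induction rule: boundary_sums_induct)
  case empty
  show ?case by (rule empty_one_cycle)
next
  case (step a b u v B)
  then have "a \<noteq> b" "u \<noteq> v"
    using simple_graph_edge[OF simple_K] simple_graph_edge[OF simple_L] by (metis doubleton_eq_iff)+
  note verts = edge_verts(1)[OF step(1)] edge_verts(2)[OF step(2)]
  have "{e \<in> boundary a b u v. (x, y) \<in> e} =
     (if x \<in> {a, b} \<and> y \<in> {u, v} then {{a, b} \<times> {y}, {x} \<times> {u, v}} else {})" for x y
    by (auto simp: boundary_def)
  moreover have "card {{a, b} \<times> {y}, {x} \<times> {u, v}} = 2" for x y
    unfolding card_2_iff using left_edge_neq_right_edge[OF step(2)] by metis
  ultimately have "even (card {e \<in> boundary a b u v. (x, y) \<in> e})" for x y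
    by (simp only: card.empty even_zero dvd_refl split: if_split) blast
  then have "even (card {e \<in> boundary a b u v. p \<in> e})" for p by (cases p) blast
  moreover have "boundary a b u v \<subseteq> edges (K \<box> L)"
    using step(1,2) verts unfolding boundary_eq_edges graph_box_def by auto
  ultimately have "boundary a b u v \<in> one_cycles (K \<box> L)"
    by (simp add: one_cycles_def)
  then show ?case using one_cycles_sum2[OF simple_box _ step(3)] by blast
qed

text \<open>The right projection of \<open>C\<close> is a cycle because it equals that of the
  remainder \<open>R\<close>, whose layers are cycles; this replaces a mirror image of the degree
  argument for the left projection.\<close>

lemma homologous_projections:
  assumes conn: "connected_graph K" "connected_graph L"
    and C: "C \<in> one_cycles (K \<box> L)" and a: "a \<in> verts K" and b: "b \<in> verts L"
  shows "right_proj K L C \<in> one_cycles K"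
    and "(C, right_cycle (right_proj K L C) b \<oplus> left_cycle a (left_proj K L C)) \<in> homology K L"
proof -
  let ?A = "left_cycle a (left_proj K L C)"
  have A: "?A \<in> one_cycles (K \<box> L)"
    using left_cycle_one_cycle[OF a left_proj_one_cycle[OF C]] .
  obtain R where R: "R \<subseteq> right_edges" "C \<oplus> ?A \<oplus> R \<in> boundary_sums K L"
    using push_left_edges[OF conn(1) a one_cycles_subset[OF C]] by blast
  \<comment> \<open>Solving for \<open>R\<close> exhibits it as a sum of cycles, as
    \<open>collapse_right_edges\<close> requires.\<close>
  have "R = C \<oplus> ?A \<oplus> (C \<oplus> ?A \<oplus> R)"
    by (intro set_eqI) (simp only: mem_sum2, argo)
  also have "\<dots> \<in> one_cycles (K \<box> L)"
    using one_cycles_sum2[OF simple_box one_cycles_sum2[OF simple_box C A]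
        boundary_sum_one_cycle[OF R(2)]] .
  finally have cyc: "R \<in> one_cycles (K \<box> L)" .
  note collapse = collapse_right_edges[OF conn(2) b R(1) cyc]
  \<comment> \<open>Applying the right projection to the boundary sum compares \<open>C\<close> with
    \<open>R\<close>, since the left cycle contributes nothing.\<close>
  have "right_proj K L C \<oplus> right_proj K L ?A \<oplus> right_proj K L R = {}"
    using proj_boundary_sum(2)[OF R(2)] by (simp only: right_proj_sum2)
  moreover have "right_proj K L ?A = {}"
    by (rule right_proj_left_cycle) (auto simp: left_proj_def)
  ultimately have eq: "right_proj K L C = right_proj K L R" by auto
  then show x: "right_proj K L C \<in> one_cycles K" using collapse(1) by simp
  \<comment> \<open>\<open>R\<close> cancels when the two boundary sums are added.\<close>
  have "C \<oplus> (right_cycle (right_proj K L R) b \<oplus> ?A) =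
      (C \<oplus> ?A \<oplus> R) \<oplus> (R \<oplus> right_cycle (right_proj K L R) b)"
    by (intro set_eqI) (simp only: mem_sum2, argo)
  also have "\<dots> \<in> boundary_sums K L"
    using R(2) collapse(2) by (rule boundary_sums_sum2)
  finally show "(C, right_cycle (right_proj K L C) b \<oplus> ?A) \<in> homology K L"
    using C layers_one_cycle[OF a b x left_proj_one_cycle[OF C]] by (simp add: homology_iff eq)
qed

text \<open>Homologous cycles have the same projections, and those of the two layers are
  \<open>D\<close> and \<open>D'\<close>.\<close>

lemma homologous_layers_unique:
  assumes "a \<in> verts K" "b \<in> verts L" "D \<subseteq> edges K" "D' \<subseteq> edges L"
    and "(C, right_cycle D b \<oplus> left_cycle a D') \<in> homology K L"
  shows "D = right_proj K L C" "D' = left_proj K L C"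
  using homologous_proj_eq[OF assms(5)] left_proj_layers right_proj_layers assms by metis+

text \<open>With base vertices fixed, pairs of cycles are in bijection with classes: the projections
  recover the pair, and every class has a representative made of two layers.\<close>

lemma card_homology_classes:
  assumes conn: "connected_graph K" "connected_graph L"
  shows "card (one_cycles (K \<box> L) // homology K L) = card (one_cycles K) * card (one_cycles L)"
proof -
  obtain a b where a: "a \<in> verts K" and b: "b \<in> verts L"
    using conn unfolding connected_graph_def by blast
  define f where "f = (\<lambda>(D, D'). homology K L `` {right_cycle D b \<oplus> left_cycle a D'})"
  have "bij_betw f (one_cycles K \<times> one_cycles L) (one_cycles (K \<box> L) // homology K L)"
  proof (rule bij_betw_imageI)
    show "inj_on f (one_cycles K \<times> one_cycles L)"
    proof (rule inj_onI, clarify)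
      fix D D' E E'
      assume D: "D \<in> one_cycles K" "D' \<in> one_cycles L" and E: "E \<in> one_cycles K" "E' \<in> one_cycles L"
        and "f (D, D') = f (E, E')"
      then have *: "(right_cycle D b \<oplus> left_cycle a D', right_cycle E b \<oplus> left_cycle a E') \<in> homology K L"
        unfolding f_def prod.case
        using eq_equiv_class[OF _ equiv_homology layers_one_cycle[OF a b E]] by blast
      \<comment> \<open>The projections of the first representative are \<open>D\<close> and
        \<open>D'\<close> by direct computation, and \<open>E\<close> and \<open>E'\<close> by
        uniqueness.\<close>
      show "D = E \<and> D' = E'"
        using homologous_layers_unique[OF a b _ _ *] D E[THEN one_cycles_subset]
          left_proj_layers[OF _ _ a] right_proj_layers[OF _ _ b] one_cycles_subset by metis
    qed
    show "f ` (one_cycles K \<times> one_cycles L) = one_cycles (K \<box> L) // homology K L"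
    proof (intro equalityI subsetI)
      fix Q assume "Q \<in> f ` (one_cycles K \<times> one_cycles L)"
      then show "Q \<in> one_cycles (K \<box> L) // homology K L"
        using layers_one_cycle[OF a b] by (auto simp: f_def intro!: quotientI)
    next
      fix Q assume "Q \<in> one_cycles (K \<box> L) // homology K L"
      then obtain C where C: "C \<in> one_cycles (K \<box> L)" "Q = homology K L `` {C}"
        by (rule quotientE)
      note h = homologous_projections[OF conn C(1) a b]
      have "Q = f (right_proj K L C, left_proj K L C)"
        unfolding C(2) f_def prod.case using equiv_class_eq[OF equiv_homology h(2)] .
      then show "Q \<in> f ` (one_cycles K \<times> one_cycles L)"
        using h(1) left_proj_one_cycle[OF C(1)] by blast
    qed
  qed
  then show ?thesis
    using bij_betw_same_card by (fastforce simp: card_cartesian_product)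
qed

end

theorem mainTheorem3:
  fixes K :: "'a ugraph" and L :: "'b ugraph"
  assumes "connected_graph K" and "connected_graph L"
  shows
    "(\<forall>C \<in> one_cycles (K \<box> L).
        \<exists>D \<in> one_cycles K. \<exists>b \<in> verts L. \<exists>a \<in> verts K. \<exists>D' \<in> one_cycles L.
        \<exists>B \<in> boundary_sums K L. C = right_cycle D b \<oplus> left_cycle a D' \<oplus> B) \<and>
     (\<forall>C \<in> one_cycles (K \<box> L). \<forall>a \<in> verts K. \<forall>b \<in> verts L.
        (\<exists>!(C\<^sub>K, C\<^sub>L) \<in> one_cycles K \<times> one_cycles L.
           (C, right_cycle C\<^sub>K b \<oplus> left_cycle a C\<^sub>L) \<in> homology K L) \<and>
        (C, right_cycle (right_proj K L C) b \<oplus> left_cycle a (left_proj K L C)) \<in> homology K L) \<and>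
     card (one_cycles (K \<box> L) // homology K L) = card (one_cycles K) * card (one_cycles L)"
proof -
  interpret two_simple_graphs K L
    using assms by unfold_locales (simp_all add: connected_graph_def)
  note h = homologous_projections[OF assms]
  \<comment> \<open>Connected graphs are nonempty by definition; any base vertices serve for the
    first claim.\<close>
  obtain a\<^sub>0 b\<^sub>0 where a\<^sub>0: "a\<^sub>0 \<in> verts K" and b\<^sub>0: "b\<^sub>0 \<in> verts L"
    using assms unfolding connected_graph_def by blast
  have decomp: "\<exists>D \<in> one_cycles K. \<exists>b \<in> verts L. \<exists>a \<in> verts K. \<exists>D' \<in> one_cycles L.
      \<exists>B \<in> boundary_sums K L. C = right_cycle D b \<oplus> left_cycle a D' \<oplus> B"
    if C: "C \<in> one_cycles (K \<box> L)" for C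
  proof -
    let ?H = "right_cycle (right_proj K L C) b\<^sub>0 \<oplus> left_cycle a\<^sub>0 (left_proj K L C)"
    have "C \<oplus> ?H \<in> boundary_sums K L"
      using h(2)[OF C a\<^sub>0 b\<^sub>0] unfolding homology_iff by blast
    \<comment> \<open>The boundary sum is \<open>C \<oplus> ?H\<close> itself: adding
      \<open>?H\<close> twice gives back \<open>C\<close>.\<close>
    moreover have "C = ?H \<oplus> (C \<oplus> ?H)"
      by (intro set_eqI) (simp only: mem_sum2, argo)
    ultimately show ?thesis
      using h(1)[OF C a\<^sub>0 b\<^sub>0] left_proj_one_cycle[OF C] a\<^sub>0 b\<^sub>0 by metis
  qed
  have unique: "\<exists>!(C\<^sub>K, C\<^sub>L) \<in> one_cycles K \<times> one_cycles L.
      (C, right_cycle C\<^sub>K b \<oplus> left_cycle a C\<^sub>L) \<in> homology K L"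
    if C: "C \<in> one_cycles (K \<box> L)" and a: "a \<in> verts K" and b: "b \<in> verts L" for C a b
  proof (rule ex1I[of _ "(right_proj K L C, left_proj K L C)"])
    show "case (right_proj K L C, left_proj K L C) of (C\<^sub>K, C\<^sub>L) \<Rightarrow>
        (C\<^sub>K, C\<^sub>L) \<in> one_cycles K \<times> one_cycles L \<and>
        (C, right_cycle C\<^sub>K b \<oplus> left_cycle a C\<^sub>L) \<in> homology K L"
      using h[OF C a b] left_proj_one_cycle[OF C] by simp
  next
    fix p
    assume p: "case p of (C\<^sub>K, C\<^sub>L) \<Rightarrow> (C\<^sub>K, C\<^sub>L) \<in> one_cycles K \<times> one_cycles L \<and>
        (C, right_cycle C\<^sub>K b \<oplus> left_cycle a C\<^sub>L) \<in> homology K L"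
    obtain D D' where "p = (D, D')" by (cases p)
    with p show "p = (right_proj K L C, left_proj K L C)"
      using homologous_layers_unique[OF a b one_cycles_subset one_cycles_subset] by auto
  qed
  show ?thesis
    using decomp unique h(2) card_homology_classes[OF assms] by simp
qed

end
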